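(* Let $G$ be a finite connected graph without loops or multiple edges, with $m$ edges, and let $w$ be a quaternionic weight on its arcs. Then \[ {\bf Z}_{\mathbb{H}}(G,w,t)=\exp\Bigl(\sum_{n\ge1}\sum_{C}\frac{2\,\mathrm{Re}\bigl(w(C)^n\bigr)}{n}t^{n|C|}\Bigr), \] where $C$ runs over all reduced cycles $C=(e_{i_1},e_{i_2},\dots,e_{i_r})$ such that $i_1i_2\cdots i_r\in L_{[2m]}$.
   Context: $\mathbb{H}$ is the real quaternion algebra; for $x=x_0+x_1i+x_2j+x_3k$, $x^*=x_0-x_1i-x_2j-x_3k$ and $\mathrm{Re}\,x=x_0$. $\mathbb{H}[[t]]$ is the ring of formal power series in a central indeterminate $t$, with $\alpha^*=\sum\alpha_k^*t^k$, and for $\beta\in\mathbb{H}[[t]]$ with zero constant term $\exp\beta=\sum_{k\ge0}\beta^k/k!$. Graph notions: $D(G)$ is the set of arcs $(u,v),(v,u)$ for edges $uv$, so $|D(G)|=2m$; for $e=(u,v)$, $o(e)=u$, $t(e)=v$, $e^{-1}=(v,u)$. The arcs are enumerated $e_1,\dots,e_{2m}$ with $e_{m+k}=e_k^{-1}$ for $k=1,\dots,m$. A quaternionic weight is a map $w:V(G)\times V(G)\to\mathbb{H}$ with $w(u,v)=0$ if $(u,v)\notin D(G)$; write $w(e)=w(u,v)$ for $e=(u,v)$. A path is a sequence $P=(e_1',\dots,e_\ell')$ of arcs with $t(e_i')=o(e_{i+1}')$; $|P|=\ell$ and $w(P)=w(e_1')w(e_2')\cdots w(e_\ell')$ (ordered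 product). $P$ has a backtracking if $e_{i+1}'=e_i'^{-1}$ for some $i$. A cycle is a path with $t(e_\ell')=o(e_1')$; it is reduced if neither $C$ nor $C^2$ (the cycle traversed twice) has a backtracking. $L_{[2m]}$ is the set of Lyndon words over the alphabet $[2m]=\{1<\dots<2m\}$ (nonempty words that are not a proper power of another word and are strictly lexicographically smallest among their cyclic rearrangements). The quaternionic weighted zeta function is ${\bf Z}_{\mathbb{H}}(G,w,t)=\prod_{C}\{(1-w(C)t^{|C|})(1-w(C)t^{|C|})^*\}^{-1}\in\mathbb{H}[[t]]$, with $C$ ranging as in the claim (each factor lies in $\mathbb{R}[[t]]$, so the order of multiplication is irrelevant; the infinite product converges $t$-adically). *)

theory Defs
  imports
    "HOL-Analysis.Infinite_Sum"
    "Graph_Theory.Digraph_Component"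
    "Graph_Theory.Pair_Digraph"
begin

section \<open>Quaternions\<close>

codatatype quat = Quat (qRe: real) (qI: real) (qJ: real) (qK: real)

lemma quat_eq_iff: "x = y \<longleftrightarrow> qRe x = qRe y \<and> qI x = qI y \<and> qJ x = qJ y \<and> qK x = qK y"
  by (auto intro: quat.expand)

instantiation quat :: ab_group_add
begin

primcorec zero_quat where
  "qRe 0 = 0" | "qI 0 = 0" | "qJ 0 = 0" | "qK 0 = 0"

primcorec plus_quat where
  "qRe (x + y) = qRe x + qRe y"
| "qI (x + y) = qI x + qI y"
| "qJ (x + y) = qJ x + qJ y"
| "qK (x + y) = qK x + qK y"

primcorec uminus_quat where
  "qRe (- x) = - qRe x"
| "qI (- x) = - qI x"
| "qJ (- x) = - qJ x"
| "qK (- x) = - qK x"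

primcorec minus_quat where
  "qRe (x - y) = qRe x - qRe y"
| "qI (x - y) = qI x - qI y"
| "qJ (x - y) = qJ x - qJ y"
| "qK (x - y) = qK x - qK y"

instance
  by standard (simp_all add: quat_eq_iff)

end

instantiation quat :: ring_1
begin

primcorec one_quat where
  "qRe 1 = 1" | "qI 1 = 0" | "qJ 1 = 0" | "qK 1 = 0"

primcorec times_quat where
  "qRe (x * y) = qRe x * qRe y - qI x * qI y - qJ x * qJ y - qK x * qK y"
| "qI (x * y) = qRe x * qI y + qI x * qRe y + qJ x * qK y - qK x * qJ y"
| "qJ (x * y) = qRe x * qJ y - qI x * qK y + qJ x * qRe y + qK x * qI y"
| "qK (x * y) = qRe x * qK y + qI x * qJ y - qJ x * qI y + qK x * qRe y"

instance
  by standard (simp_all add: quat_eq_iff algebra_simps)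

end

primcorec qcnj :: "quat \<Rightarrow> quat" where
  "qRe (qcnj x) = qRe x"
| "qI (qcnj x) = - qI x"
| "qJ (qcnj x) = - qJ x"
| "qK (qcnj x) = - qK x"

instantiation quat :: real_algebra_1
begin

primcorec scaleR_quat where
  "qRe (scaleR r x) = r * qRe x"
| "qI (scaleR r x) = r * qI x"
| "qJ (scaleR r x) = r * qJ x"
| "qK (scaleR r x) = r * qK x"

instance
  by standard (simp_all add: quat_eq_iff algebra_simps)

end

instantiation quat :: real_div_algebra
begin

definition inverse_quat :: "quat \<Rightarrow> quat" where
  "inverse x = inverse ((qRe x)\<^sup>2 + (qI x)\<^sup>2 + (qJ x)\<^sup>2 + (qK x)\<^sup>2) *\<^sub>R qcnj x"

definition divide_quat :: "quat \<Rightarrow> quat \<Rightarrow> quat" where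
  "x div y = x * inverse y" for x y :: quat

lemma quat_norm_eq_0:
  "(qRe x)\<^sup>2 + (qI x)\<^sup>2 + (qJ x)\<^sup>2 + (qK x)\<^sup>2 = 0 \<longleftrightarrow> x = 0"
proof
  assume *: "(qRe x)\<^sup>2 + (qI x)\<^sup>2 + (qJ x)\<^sup>2 + (qK x)\<^sup>2 = 0"
  note nn = zero_le_power2[of "qRe x"] zero_le_power2[of "qI x"]
    zero_le_power2[of "qJ x"] zero_le_power2[of "qK x"]
  have "(qRe x)\<^sup>2 = 0" "(qI x)\<^sup>2 = 0" "(qJ x)\<^sup>2 = 0" "(qK x)\<^sup>2 = 0"
    using * nn by linarith+
  then show "x = 0" by (simp add: quat_eq_iff)
qed simp

lemma quat_mult_cnj:
  "x * qcnj x = ((qRe x)\<^sup>2 + (qI x)\<^sup>2 + (qJ x)\<^sup>2 + (qK x)\<^sup>2) *\<^sub>R 1"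
  "qcnj x * x = ((qRe x)\<^sup>2 + (qI x)\<^sup>2 + (qJ x)\<^sup>2 + (qK x)\<^sup>2) *\<^sub>R 1"
  by (simp_all add: quat_eq_iff power2_eq_square)

instance
proof
  fix x y :: quat
  show "inverse (0 :: quat) = 0"
    by (simp add: inverse_quat_def)
  show "x \<noteq> 0 \<Longrightarrow> inverse x * x = 1" "x \<noteq> 0 \<Longrightarrow> x * inverse x = 1"
    using quat_norm_eq_0[of x] by (simp_all add: inverse_quat_def quat_mult_cnj)
  show "x div y = x * inverse y"
    by (simp add: divide_quat_def)
qed

end


section \<open>Power series over the quaternions\<close>

text \<open>
  The topology on \<^typ>\<open>'a fps\<close> is the \<open>t\<close>-adic one; infinite sums and products below are
  limits in it.
\<close>

definition fps_cnj :: "quat fps \<Rightarrow> quat fps" where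
  "fps_cnj \<alpha> = Abs_fps (\<lambda>k. qcnj (fps_nth \<alpha> k))"

definition fps_Exp :: "quat fps \<Rightarrow> quat fps" where
  "fps_Exp \<beta> = (\<Sum>k. fps_const (1 / fact k) * \<beta> ^ k)"

text \<open>
  Multiplicative analogue of \<^const>\<open>infsum\<close>. The ring is not commutative, so
  \<^const>\<open>prod\<close> is not available; the \<^const>\<open>Finite_Set.fold\<close> is the product of the
  \<open>f x\<close> in an arbitrary order and is meaningful when these commute pairwise.
\<close>

definition infprod :: "('b \<Rightarrow> 'a :: {monoid_mult, t2_space}) \<Rightarrow> 'b set \<Rightarrow> 'a" where
  "infprod f A = Lim (finite_subsets_at_top A) (Finite_Set.fold (\<lambda>x y. f x * y) 1)"


section \<open>Lyndon words\<close>

definition proper_power :: "'b list \<Rightarrow> bool" where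
  "proper_power xs \<longleftrightarrow> (\<exists>ys k. k \<ge> 2 \<and> xs = concat (replicate k ys))"

definition lyndon_words :: "'b :: linorder set \<Rightarrow> 'b list set" where
  "lyndon_words A = {xs. xs \<noteq> [] \<and> set xs \<subseteq> A \<and> \<not> proper_power xs \<and>
     (\<forall>k. 0 < k \<and> k < length xs \<longrightarrow> ord_class.lexordp xs (rotate k xs))}"


section \<open>Cycles in graphs\<close>

text \<open>
  A graph is a symmetric loop-free digraph \<open>G\<close> whose arcs are pairs of vertices, so that \<open>D(G)\<close> is
  \<^term>\<open>parcs G\<close>, and origin, terminus and inverse of an arc are \<^const>\<open>fst\<close>, \<^const>\<open>snd\<close> and
  \<^const>\<open>prod.swap\<close>.
\<close>

definition undirected_edges :: "'v pair_pre_digraph \<Rightarrow> 'v set set" where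
  "undirected_edges G = {{u, v} | u v. (u, v) \<in> parcs G}"

definition arc_enumeration :: "'v pair_pre_digraph \<Rightarrow> nat \<Rightarrow> (nat \<Rightarrow> 'v \<times> 'v) \<Rightarrow> bool" where
  "arc_enumeration G m e \<longleftrightarrow>
     bij_betw e {1..2 * m} (parcs G) \<and> (\<forall>k\<in>{1..m}. e (m + k) = prod.swap (e k))"

definition quat_weight :: "'v pair_pre_digraph \<Rightarrow> ('v \<times> 'v \<Rightarrow> quat) \<Rightarrow> bool" where
  "quat_weight G w \<longleftrightarrow> (\<forall>u\<in>pverts G. \<forall>v\<in>pverts G. (u, v) \<notin> parcs G \<longrightarrow> w (u, v) = 0)"

definition is_path :: "'v pair_pre_digraph \<Rightarrow> ('v \<times> 'v) list \<Rightarrow> bool" where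
  "is_path G P \<longleftrightarrow> P \<noteq> [] \<and> set P \<subseteq> parcs G \<and>
     (\<forall>i. Suc i < length P \<longrightarrow> snd (P ! i) = fst (P ! Suc i))"

definition path_weight :: "('v \<times> 'v \<Rightarrow> quat) \<Rightarrow> ('v \<times> 'v) list \<Rightarrow> quat" where
  "path_weight w P = prod_list (map w P)"

definition has_backtracking :: "('v \<times> 'v) list \<Rightarrow> bool" where
  "has_backtracking P \<longleftrightarrow> (\<exists>i. Suc i < length P \<and> P ! Suc i = prod.swap (P ! i))"

definition is_cycle :: "'v pair_pre_digraph \<Rightarrow> ('v \<times> 'v) list \<Rightarrow> bool" where
  "is_cycle G C \<longleftrightarrow> is_path G C \<and> snd (last C) = fst (hd C)"

definition reduced_cycle :: "'v pair_pre_digraph \<Rightarrow> ('v \<times> 'v) list \<Rightarrow> bool" where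
  "reduced_cycle G C \<longleftrightarrow> is_cycle G C \<and> \<not> has_backtracking C \<and> \<not> has_backtracking (C @ C)"

definition lyndon_cycles ::
  "'v pair_pre_digraph \<Rightarrow> nat \<Rightarrow> (nat \<Rightarrow> 'v \<times> 'v) \<Rightarrow> ('v \<times> 'v) list set" where
  "lyndon_cycles G m e = {map e ks | ks. ks \<in> lyndon_words {1..2 * m} \<and> reduced_cycle G (map e ks)}"

definition quat_zeta ::
  "'v pair_pre_digraph \<Rightarrow> nat \<Rightarrow> (nat \<Rightarrow> 'v \<times> 'v) \<Rightarrow> ('v \<times> 'v \<Rightarrow> quat) \<Rightarrow> quat fps" where
  "quat_zeta G m e w =
     infprod
       (\<lambda>C. inverse ((1 - fps_const (path_weight w C) * fps_X ^ length C) *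
              fps_cnj (1 - fps_const (path_weight w C) * fps_X ^ length C)))
       (lyndon_cycles G m e)"

end

theory Submission
  imports Defs
begin

text \<open>
  Since \<open>(1 - q t\<^sup>l) (1 - q t\<^sup>l)\<^sup>* = 1 - 2 Re(q) t\<^sup>l + |q|\<^sup>2 t\<^sup>2\<^sup>l\<close> is real, everything
  happens in the commutative ring of real power series. For \<open>l = 1\<close>, the Cayley-Hamilton recurrence
  \<open>s\<^sub>n\<^sub>+\<^sub>2 = 2 Re(q) s\<^sub>n\<^sub>+\<^sub>1 - |q|\<^sup>2 s\<^sub>n\<close> for \<open>s\<^sub>n = 2 Re(q\<^sup>n)\<close> says that the logarithmic
  derivative of this factor is \<open>-H'\<close> with \<open>H = \<Sum>\<^sub>n s\<^sub>n t\<^sup>n / n\<close>; substituting \<open>t\<^sup>l\<close> gives the general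
  factor. The relation \<open>H' P = - P'\<close> is stable under finite sums of the \<open>H\<close> and products of the \<open>P\<close>,
  and implies \<open>exp H = 1 / P\<close>. As only finitely many cycles have a given length, the \<open>t\<close>-adic
  limit over finite sets of cycles yields the identity.
\<close>

section \<open>Real power series inside power series over a real algebra\<close>

definition fps_of_real :: "real fps \<Rightarrow> 'a::real_algebra_1 fps" where
  "fps_of_real f = Abs_fps (\<lambda>n. of_real (fps_nth f n))"

lemma fps_of_real_nth [simp]: "fps_nth (fps_of_real f) n = of_real (fps_nth f n)"
  by (simp add: fps_of_real_def)

lemma fps_of_real_1 [simp]: "fps_of_real 1 = 1"
  by (simp add: fps_eq_iff)

lemma fps_of_real_mult: "fps_of_real (f * g) = fps_of_real f * fps_of_real g"
  by (simp add: fps_eq_iff fps_mult_nth)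

lemma fps_of_real_power: "fps_of_real (f ^ n) = fps_of_real f ^ n"
  by (induction n) (simp_all add: fps_of_real_mult)

lemma of_real_mult_commute: "of_real r * x = x * (of_real r :: 'a::real_algebra_1)"
  by (simp add: of_real_def)

text \<open>Real scalars are central in the algebra and the indeterminate is central, so embedded
  real series are central too.\<close>

lemma fps_of_real_commute: "fps_of_real f * g = g * (fps_of_real f :: 'a::real_algebra_1 fps)"
proof (rule fps_ext)
  fix n
  have "fps_nth (fps_of_real f * g) n = (\<Sum>i=0..n. fps_nth g (n - i) * of_real (fps_nth f i))"
    by (simp add: fps_mult_nth of_real_mult_commute)
  also have "\<dots> = (\<Sum>i=0..n. fps_nth g i * of_real (fps_nth f (n - i)))"
    by (rule sum.reindex_bij_witness[of _ "\<lambda>i. n - i" "\<lambda>i. n - i"]) auto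
  also have "\<dots> = fps_nth (g * fps_of_real f) n"
    by (simp add: fps_mult_nth)
  finally show "fps_nth (fps_of_real f * g) n = fps_nth (g * fps_of_real f) n" .
qed

lemma fps_of_real_inverse:
  assumes "fps_nth f 0 \<noteq> 0"
  shows "inverse (fps_of_real f :: 'a::real_div_algebra fps) = fps_of_real (inverse f)"
  by (rule fps_inverse_unique)
     (simp add: inverse_mult_eq_1'[OF assms] flip: fps_of_real_mult)

lemma tendsto_fps_of_real:
  "filterlim f (nhds S) F \<Longrightarrow> filterlim (\<lambda>x. fps_of_real (f x)) (nhds (fps_of_real S)) F"
  unfolding tendsto_fps_iff by simp

lemma has_sum_fps_of_real:
  assumes "(f has_sum S) A"
  shows "((\<lambda>x. fps_of_real (f x)) has_sum (fps_of_real S :: 'a::real_algebra_1 fps)) A"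
proof -
  have "(\<lambda>F. \<Sum>x\<in>F. fps_of_real (f x) :: 'a fps) = (\<lambda>F. fps_of_real (sum f F))"
    by (simp add: fun_eq_iff fps_eq_iff fps_sum_nth)
  with assms show ?thesis
    using tendsto_fps_of_real[of "sum f" S] unfolding has_sum_def by simp
qed

text \<open>Left multiplications by central factors commute, so the fold does not depend on the
  order and is the product taken in the commutative ring of real series.\<close>

lemma fold_mult_fps_of_real:
  fixes f :: "'i \<Rightarrow> 'a::real_algebra_1 fps"
  assumes "finite F" and f: "\<And>x. x \<in> F \<Longrightarrow> f x = fps_of_real (g x)"
  shows "Finite_Set.fold (\<lambda>x y. f x * y) 1 F = fps_of_real (prod g F)"
proof -
  interpret comp_fun_commute_on F "\<lambda>x y. f x * y"
  proof
    fix x y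
    assume "x \<in> F" "y \<in> F"
    then have "f y * f x = f x * f y"
      using fps_of_real_commute[of "g y" "f x"] by (simp add: f)
    then show "(\<lambda>z. f y * z) \<circ> (\<lambda>z. f x * z) = (\<lambda>z. f x * z) \<circ> (\<lambda>z. f y * z)"
      by (simp add: fun_eq_iff mult.assoc[symmetric])
  qed
  \<comment> \<open>The induction runs over subsets of \<open>F\<close>, because commutation is
    available only on \<open>F\<close>.\<close>
  have "Finite_Set.fold (\<lambda>x y. f x * y) 1 E = fps_of_real (prod g E)" if "finite E" "E \<subseteq> F" for E
    using that by (induction E) (simp_all add: f fps_of_real_mult)
  with assms(1) show ?thesis
    by blast
qed


section \<open>Sums and exponentials of power series\<close>

text \<open>\<open>B k\<close> may be any finite index set containing the support of the
  \<open>k\<close>-th coefficient; this freedom lets different families share the same index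
  sets.\<close>

lemma has_sum_fpsI_superset:
  assumes "\<And>k. finite (B k)" "\<And>k. B k \<subseteq> A"
    and zero: "\<And>k x. x \<in> A \<Longrightarrow> x \<notin> B k \<Longrightarrow> fps_nth (f x) k = 0"
  shows "(f has_sum Abs_fps (\<lambda>k. \<Sum>x\<in>B k. fps_nth (f x) k)) A"
proof (rule has_sum_fpsI)
  fix k
  have sub: "{x \<in> A. fps_nth (f x) k \<noteq> 0} \<subseteq> B k"
    using zero by blast
  then show "finite {x \<in> A. fps_nth (f x) k \<noteq> 0}"
    using assms(1) finite_subset by blast
  show "fps_nth (Abs_fps (\<lambda>k. \<Sum>x\<in>B k. fps_nth (f x) k)) k =
      (\<Sum>x | x \<in> A \<and> fps_nth (f x) k \<noteq> 0. fps_nth (f x) k)"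
    using assms(1,2) sub by (auto intro!: sum.mono_neutral_right)
qed

lemma fps_power_nth_cong:
  assumes "\<And>j. j \<le> k \<Longrightarrow> fps_nth f j = fps_nth g j" and "j \<le> k"
  shows "fps_nth (f ^ i) j = fps_nth (g ^ i) j"
  using assms(2)
proof (induction i arbitrary: j)
  case (Suc i)
  then show ?case
    by (auto simp: fps_mult_nth assms(1) intro!: sum.cong)
qed simp

text \<open>Coefficient \<open>k\<close> of \<open>g oo f\<close> involves only coefficients
  \<open>0\<close> to \<open>k\<close> of \<open>f\<close>, and these finitely many eventually agree
  with those of the limit.\<close>

lemma tendsto_fps_compose:
  fixes f :: "'i \<Rightarrow> 'a::ring_1 fps"
  assumes "filterlim f (nhds S) F"
  shows "filterlim (\<lambda>x. g oo f x) (nhds (g oo S)) F"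
proof (rule tendsto_fpsI)
  fix k
  have "\<forall>\<^sub>F x in F. \<forall>j\<in>{..k}. fps_nth (f x) j = fps_nth S j"
    using assms unfolding tendsto_fps_iff by (subst eventually_ball_finite_distrib) auto
  then show "\<forall>\<^sub>F x in F. fps_nth (g oo f x) k = fps_nth (g oo S) k"
  proof eventually_elim
    case (elim x)
    then show ?case
      using fps_power_nth_cong[of k "f x" S k] by (simp add: fps_compose_nth)
  qed
qed

text \<open>Without a constant term, \<open>S ^ i\<close> contributes nothing to coefficient
  \<open>k\<close> once \<open>i > k\<close>, so the partial sums are stable there from
  \<open>N = k + 1\<close> on.\<close>

lemma fps_Exp_fps_of_real:
  assumes "fps_nth S 0 = 0"
  shows "fps_Exp (fps_of_real S) = fps_of_real (fps_exp 1 oo S)"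
proof -
  have "fps_nth (\<Sum>i<N. fps_const (1 / fact i) * fps_of_real S ^ i) k =
      (fps_nth (fps_of_real (fps_exp 1 oo S)) k :: quat)" if "k < N" for k N
  proof -
    have "fps_nth (\<Sum>i<N. fps_const (1 / fact i) * fps_of_real S ^ i) k =
        (\<Sum>i<N. of_real (fps_nth (S ^ i) k / fact i) :: quat)"
      by (simp add: fps_sum_nth flip: fps_of_real_power)
        (simp add: divide_inverse flip: of_real_mult_commute)
    also have "\<dots> = of_real (\<Sum>i<N. fps_nth (S ^ i) k / fact i)"
      by simp
    also have "(\<Sum>i<N. fps_nth (S ^ i) k / fact i) = (\<Sum>i=0..k. fps_nth (S ^ i) k / fact i)"
      using that startsby_zero_power_prefix[OF assms]
      by (intro sum.mono_neutral_right) auto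
    finally show ?thesis
      by (simp add: fps_compose_nth)
  qed
  then have "(\<lambda>N. \<Sum>i<N. fps_const (1 / fact i) * fps_of_real S ^ i)
      \<longlonglongrightarrow> (fps_of_real (fps_exp 1 oo S) :: quat fps)"
    by (intro tendsto_fpsI) (auto intro: eventually_mono[OF eventually_gt_at_top])
  then have "(\<lambda>i. fps_const (1 / fact i) * fps_of_real S ^ i) sums
      (fps_of_real (fps_exp 1 oo S) :: quat fps)"
    by (simp add: sums_def)
  then show ?thesis
    by (simp add: fps_Exp_def sums_iff)
qed

text \<open>By \<open>ode\<close> the product of \<open>P\<close> and the exponential of
  \<open>H\<close> has derivative zero, hence equals its constant term 1.\<close>

lemma fps_exp_compose_eq_inverse:
  fixes H P :: "'a::field_char_0 fps"
  assumes "fps_nth H 0 = 0" "fps_nth P 0 = 1"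
    and ode: "fps_deriv H * P = - fps_deriv P"
  shows "fps_exp 1 oo H = inverse P"
proof -
  let ?E = "fps_exp 1 oo H"
  have "fps_deriv (P * ?E) = fps_deriv P * ?E + P * (?E * fps_deriv H)"
    by (simp add: fps_compose_deriv[OF assms(1)] algebra_simps)
  also have "\<dots> = ?E * (fps_deriv P + fps_deriv H * P)"
    by (simp add: algebra_simps)
  also have "\<dots> = 0"
    by (simp add: ode)
  finally have "P * ?E = fps_const (fps_nth (P * ?E) 0)"
    by (simp only: fps_deriv_eq_0_iff)
  also have "\<dots> = 1"
    using assms(2) by simp
  finally show ?thesis
    by (rule fps_inverse_unique[symmetric])
qed

text \<open>Additivity of the logarithmic derivative, in a form free of division.\<close>

lemma fps_deriv_sum_mult_prod:
  fixes H P :: "'i \<Rightarrow> 'a::comm_ring_1 fps"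
  assumes "finite F" "\<And>x. x \<in> F \<Longrightarrow> fps_deriv (H x) * P x = - fps_deriv (P x)"
  shows "fps_deriv (sum H F) * prod P F = - fps_deriv (prod P F)"
  using assms
proof (induction F)
  case (insert x F)
  have "fps_deriv (sum H (insert x F)) * prod P (insert x F) =
      (fps_deriv (H x) * P x) * prod P F + P x * (fps_deriv (sum H F) * prod P F)"
    using insert.hyps by (simp add: algebra_simps)
  also have "\<dots> = - fps_deriv (prod P (insert x F))"
    using insert by (simp add: algebra_simps)
  finally show ?case .
qed simp


section \<open>A single factor of the zeta function\<close>

definition qnorm2 :: "quat \<Rightarrow> real" where
  "qnorm2 x = (qRe x)\<^sup>2 + (qI x)\<^sup>2 + (qJ x)\<^sup>2 + (qK x)\<^sup>2"

lemma quat_of_real_sel [simp]: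
  "qRe (of_real r) = r" "qI (of_real r) = 0" "qJ (of_real r) = 0" "qK (of_real r) = 0"
  by (simp_all add: of_real_def)

text \<open>Multiply the Cayley-Hamilton identity q^2 = 2 Re(q) q - |q|^2 by q^n and take real
  parts.\<close>

lemma qRe_power_rec:
  "qRe (q ^ Suc (Suc n)) = 2 * qRe q * qRe (q ^ Suc n) - qnorm2 q * qRe (q ^ n)"
  by (simp add: qnorm2_def algebra_simps power2_eq_square)

definition zeta_factor :: "quat \<Rightarrow> nat \<Rightarrow> real fps" where
  "zeta_factor q l = 1 - fps_const (2 * qRe q) * fps_X ^ l + fps_const (qnorm2 q) * fps_X ^ (2 * l)"

definition log_term :: "quat \<Rightarrow> nat \<Rightarrow> nat \<Rightarrow> real fps" where
  "log_term q l n = fps_const (2 * qRe (q ^ n) / real n) * fps_X ^ (n * l)"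

text \<open>Division by zero gives 0, so the inner series has no constant term. Writing it as a
  composition reduces the differential equation to the case \<open>l = 1\<close>.\<close>

definition zeta_log :: "quat \<Rightarrow> nat \<Rightarrow> real fps" where
  "zeta_log q l = Abs_fps (\<lambda>n. 2 * qRe (q ^ n) / real n) oo fps_X ^ l"

lemma quat_factor_eq:
  "(1 - fps_const q * fps_X ^ l) * fps_cnj (1 - fps_const q * fps_X ^ l) =
     fps_of_real (zeta_factor q l)"
proof -
  have cnj: "fps_cnj (1 - fps_const q * fps_X ^ l) = 1 - fps_const (qcnj q) * fps_X ^ l"
    by (simp add: fps_cnj_def fps_eq_iff fps_X_power_nth quat_eq_iff)
  have "(1 - fps_const q * fps_X ^ l) * (1 - fps_const (qcnj q) * fps_X ^ l) =
      1 - fps_const (q + qcnj q) * fps_X ^ l +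
        fps_const q * (fps_X ^ l * fps_const (qcnj q)) * fps_X ^ l"
    by (simp add: algebra_simps flip: fps_const_add)
  \<comment> \<open>Centrality of the indeterminate brings \<open>q\<close> next to its conjugate,
    where they multiply to the squared norm.\<close>
  also have "fps_X ^ l * fps_const (qcnj q) = fps_const (qcnj q) * fps_X ^ l"
    by (rule fps_mult_fps_X_power_commute)
  also have "fps_const q * (fps_const (qcnj q) * fps_X ^ l) * fps_X ^ l =
      fps_const (of_real (qnorm2 q)) * fps_X ^ (2 * l)"
    by (simp add: mult.assoc power_add[symmetric] mult_2 quat_mult_cnj qnorm2_def of_real_def
        flip: fps_const_mult)
       (simp add: mult.assoc[symmetric] quat_mult_cnj)
  also have "q + qcnj q = of_real (2 * qRe q)"
    by (simp add: quat_eq_iff del: of_real_mult)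
  finally show ?thesis
    unfolding cnj by (simp add: zeta_factor_def fps_eq_iff fps_X_power_nth)
qed

lemma zeta_factor_nth_0: "l > 0 \<Longrightarrow> fps_nth (zeta_factor q l) 0 = 1"
  by (simp add: zeta_factor_def fps_X_power_nth)

lemma zeta_log_nth: "fps_nth (zeta_log q l) k = (\<Sum>n\<in>{1..k}. fps_nth (log_term q l n) k)"
proof -
  have "fps_nth (zeta_log q l) k = (\<Sum>n\<in>{0..k}. fps_nth (log_term q l n) k)"
    by (simp add: zeta_log_def log_term_def fps_compose_nth power_mult mult.commute[of _ l])
  also have "\<dots> = (\<Sum>n\<in>{1..k}. fps_nth (log_term q l n) k)"
    by (rule sum.mono_neutral_right) (auto simp: log_term_def not_le)
  finally show ?thesis .
qed

lemma zeta_log_deriv: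
  assumes "l > 0"
  shows "fps_deriv (zeta_log q l) * zeta_factor q l = - fps_deriv (zeta_factor q l)"
proof -
  define H where "H = Abs_fps (\<lambda>n. 2 * qRe (q ^ n) / real n)"
  define P where "P = 1 - fps_const (2 * qRe q) * fps_X + fps_const (qnorm2 q) * fps_X ^ 2"
  have X0: "fps_nth (fps_X ^ l :: real fps) 0 = 0"
    using assms by simp
  have H': "fps_deriv H = Abs_fps (\<lambda>n. 2 * qRe (q ^ Suc n))"
    by (simp add: H_def fps_eq_iff del: power_Suc)
  have "fps_deriv H * P = - fps_deriv P"
  proof (rule fps_ext)
    fix n
    have eq: "fps_deriv H * P = fps_deriv H - fps_const (2 * qRe q) * (fps_X * fps_deriv H)
        + fps_const (qnorm2 q) * (fps_X * (fps_X * fps_deriv H))"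
      by (simp add: P_def algebra_simps power2_eq_square)
    have P': "fps_deriv P = - fps_const (2 * qRe q) + fps_const (2 * qnorm2 q) * fps_X"
      by (simp add: P_def fps_eq_iff fps_X_power_nth)
    \<comment> \<open>\<open>- fps_deriv P\<close> has only coefficients 0 and 1. The recurrence
      cancels all higher ones; for \<open>n = 1\<close> its last term has \<open>q ^ 0\<close>,
      which produces the squared norm.\<close>
    consider "n = 0" | "n = 1" | k where "n = Suc (Suc k)"
      by (metis One_nat_def not0_implies_Suc)
    then show "fps_nth (fps_deriv H * P) n = fps_nth (- fps_deriv P) n"
    proof cases
      case 1
      then show ?thesis
        unfolding eq P' by (simp add: H')
    next
      case 2
      then show ?thesis
        unfolding eq P' using qRe_power_rec[of q 0] by (simp add: H')
    next
      case 3
      then show ?thesis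
        unfolding eq P' using qRe_power_rec[of q "Suc k"] by (simp add: H' del: power_Suc)
    qed
  qed
  \<comment> \<open>Substituting \<open>fps_X ^ l\<close> is multiplicative because it has zero
    constant term.\<close>
  then have "(fps_deriv H oo fps_X ^ l) * (P oo fps_X ^ l) = - (fps_deriv P oo fps_X ^ l)"
    by (simp add: fps_compose_mult_distrib[OF X0, symmetric] fps_compose_uminus)
  moreover have "P oo fps_X ^ l = zeta_factor q l"
    by (simp add: P_def zeta_factor_def fps_compose_add_distrib fps_compose_sub_distrib
        fps_compose_mult_distrib[OF X0] fps_compose_power[OF X0, symmetric] fps_X_fps_compose_startby0[OF X0]
        mult.commute[of _ l] power_mult)
  ultimately have *: "(fps_deriv H oo fps_X ^ l) * zeta_factor q l = - (fps_deriv P oo fps_X ^ l)"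
    and P: "zeta_factor q l = P oo fps_X ^ l"
    by simp_all
  \<comment> \<open>The chain rule multiplies both sides by the same derivative of
    \<open>fps_X ^ l\<close>.\<close>
  have "fps_deriv (zeta_log q l) * zeta_factor q l =
      ((fps_deriv H oo fps_X ^ l) * zeta_factor q l) * fps_deriv (fps_X ^ l)"
    unfolding zeta_log_def H_def[symmetric] fps_compose_deriv[OF X0] by (simp only: mult_ac)
  also have "\<dots> = - fps_deriv (zeta_factor q l)"
    unfolding * unfolding P fps_compose_deriv[OF X0] by (rule mult_minus_left)
  finally show ?thesis .
qed

lemma prod_zeta_factor:
  assumes "finite F" "\<And>x. x \<in> F \<Longrightarrow> l x > 0"
  shows "(\<Prod>x\<in>F. inverse (zeta_factor (q x) (l x))) =
    fps_exp 1 oo (\<Sum>x\<in>F. zeta_log (q x) (l x))"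
proof -
  have "fps_exp 1 oo (\<Sum>x\<in>F. zeta_log (q x) (l x)) = inverse (\<Prod>x\<in>F. zeta_factor (q x) (l x))"
  proof (rule fps_exp_compose_eq_inverse)
    show "fps_nth (\<Sum>x\<in>F. zeta_log (q x) (l x)) 0 = 0"
      by (simp add: fps_sum_nth zeta_log_nth)
    show "fps_nth (\<Prod>x\<in>F. zeta_factor (q x) (l x)) 0 = 1"
      using assms(2) by (induction F rule: infinite_finite_induct) (simp_all add: zeta_factor_nth_0)
    show "fps_deriv (\<Sum>x\<in>F. zeta_log (q x) (l x)) * (\<Prod>x\<in>F. zeta_factor (q x) (l x)) =
        - fps_deriv (\<Prod>x\<in>F. zeta_factor (q x) (l x))"
      using assms by (intro fps_deriv_sum_mult_prod zeta_log_deriv) auto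
  qed
  then show ?thesis
    by (simp add: inverse_prod_fps)
qed


section \<open>The infinite product\<close>

text \<open>Positive lengths, finitely many below each bound, make every coefficient a finite
  computation; the identity for finite products then passes to the limit.\<close>

theorem infprod_quat_factors:
  fixes q :: "'i \<Rightarrow> quat" and l :: "'i \<Rightarrow> nat"
  assumes pos: "\<And>x. x \<in> A \<Longrightarrow> l x > 0"
    and fin: "\<And>k. finite {x \<in> A. l x \<le> k}"
  shows "infprod (\<lambda>x. inverse ((1 - fps_const (q x) * fps_X ^ l x) *
           fps_cnj (1 - fps_const (q x) * fps_X ^ l x))) A =
    fps_Exp (\<Sum>\<^sub>\<infinity>n\<in>{1..}. \<Sum>\<^sub>\<infinity>x\<in>A.
      fps_const (of_real (2 * qRe (q x ^ n) / real n)) * fps_X ^ (n * l x))"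
proof -
  define B where "B k = {x \<in> A. l x \<le> k}" for k
  define c where "c n x = log_term (q x) (l x) n" for n x
  define T where "T n = Abs_fps (\<lambda>k. \<Sum>x\<in>B k. fps_nth (c n x) k)" for n
  define S where "S = Abs_fps (\<lambda>k. \<Sum>n\<in>{1..k}. fps_nth (T n) k)"
  have B: "finite (B k)" "B k \<subseteq> A" for k
    using fin by (auto simp: B_def)
  have cz: "fps_nth (c n x) k = 0" if "k < n * l x" for n x k
    using that by (simp add: c_def log_term_def fps_X_power_nth)
  have T: "(c n has_sum T n) A" if "n \<ge> 1" for n
    unfolding T_def
  proof (rule has_sum_fpsI_superset[OF B])
    fix k x assume "x \<in> A" "x \<notin> B k"
    then have "1 * k < n * l x"
      using that by (intro mult_le_less_imp_less) (auto simp: B_def)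
    then show "fps_nth (c n x) k = 0"
      by (simp add: cz)
  qed
  have S: "(T has_sum S) {1..}"
    unfolding S_def
  proof (rule has_sum_fpsI_superset)
    fix k n :: nat assume n: "n \<in> {1..}" "n \<notin> {1..k}"
    have "k < n * l x" if "x \<in> A" for x
      using n pos[OF that] by (cases "l x") auto
    then have "fps_nth (c n x) k = 0" if "x \<in> B k" for x
      using that B(2) by (auto intro!: cz)
    then show "fps_nth (T n) k = 0"
      by (simp add: T_def)
  qed auto
  \<comment> \<open>The product groups the double sum by \<open>x\<close>, the claim by
    \<open>n\<close>; in each coefficient the exchange is one of finite sums.\<close>
  have S_swap: "S = Abs_fps (\<lambda>k. \<Sum>x\<in>B k. fps_nth (zeta_log (q x) (l x)) k)"
    unfolding S_def T_def c_def by (simp add: fps_eq_iff zeta_log_nth sum.swap[of _ "B _"])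
  have "((\<lambda>x. zeta_log (q x) (l x)) has_sum S) A"
    unfolding S_swap
  proof (rule has_sum_fpsI_superset[OF B])
    fix k x assume "x \<in> A" "x \<notin> B k"
    then have "fps_nth (log_term (q x) (l x) n) k = 0" if "n \<in> {1..k}" for n
      using that mult_le_less_imp_less[of 1 n k "l x"] cz[of k n x] by (auto simp: B_def c_def)
    then show "fps_nth (zeta_log (q x) (l x)) k = 0"
      by (simp add: zeta_log_nth)
  qed
  then have lim: "((\<lambda>F. fps_of_real (fps_exp 1 oo (\<Sum>x\<in>F. zeta_log (q x) (l x)))) \<longlongrightarrow>
      (fps_of_real (fps_exp 1 oo S) :: quat fps)) (finite_subsets_at_top A)"
    unfolding has_sum_def by (intro tendsto_fps_of_real tendsto_fps_compose)
  define f where "f x = inverse ((1 - fps_const (q x) * fps_X ^ l x) *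
    fps_cnj (1 - fps_const (q x) * fps_X ^ l x))" for x
  have f: "f x = fps_of_real (inverse (zeta_factor (q x) (l x)))" if "x \<in> A" for x
    using pos[OF that] by (simp add: f_def quat_factor_eq fps_of_real_inverse zeta_factor_nth_0)
  have "fps_of_real (fps_exp 1 oo (\<Sum>x\<in>F. zeta_log (q x) (l x))) =
      Finite_Set.fold (\<lambda>x y. f x * y) 1 F" if F: "finite F" "F \<subseteq> A" for F
    using F pos f by (subst fold_mult_fps_of_real[OF F(1)]) (auto simp: prod_zeta_factor subset_iff)
  then have "(Finite_Set.fold (\<lambda>x y. f x * y) 1 \<longlongrightarrow> fps_of_real (fps_exp 1 oo S))
      (finite_subsets_at_top A)"
    by (intro Lim_transform_eventually[OF lim] eventually_finite_subsets_at_top_weakI)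
  then have "infprod f A = fps_of_real (fps_exp 1 oo S)"
    unfolding infprod_def by (intro tendsto_Lim) auto
  also have "\<dots> = fps_Exp (fps_of_real S)"
    by (rule fps_Exp_fps_of_real[symmetric]) (simp add: S_def)
  also have "fps_of_real S = (\<Sum>\<^sub>\<infinity>n\<in>{1..}. fps_of_real (T n))"
    using has_sum_fps_of_real[OF S] by (rule infsumI[symmetric])
  also have "\<dots> = (\<Sum>\<^sub>\<infinity>n\<in>{1..}. \<Sum>\<^sub>\<infinity>x\<in>A. fps_of_real (c n x))"
    using has_sum_fps_of_real[OF T] by (intro infsum_cong) (auto intro!: infsumI[symmetric])
  also have "(\<lambda>n x. fps_of_real (c n x) :: quat fps) = (\<lambda>n x.
      fps_const (of_real (2 * qRe (q x ^ n) / real n)) * fps_X ^ (n * l x))"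
    by (simp add: c_def log_term_def fun_eq_iff fps_eq_iff fps_X_power_nth)
  finally show ?thesis
    unfolding f_def .
qed

theorem theorem6p2:
  fixes G :: "'v pair_pre_digraph" and m :: nat
    and e :: "nat \<Rightarrow> 'v \<times> 'v" and w :: "'v \<times> 'v \<Rightarrow> quat"
  assumes "pair_graph G"
    and "Digraph_Component.connected (with_proj G)"
    and "m = card (undirected_edges G)"
    and "arc_enumeration G m e"
    and "quat_weight G w"
  shows "quat_zeta G m e w =
    fps_Exp (\<Sum>\<^sub>\<infinity>n\<in>{1..}. \<Sum>\<^sub>\<infinity>C\<in>lyndon_cycles G m e.
      fps_const (of_real (2 * qRe (path_weight w C ^ n) / real n)) * fps_X ^ (n * length C))"
  unfolding quat_zeta_def
proof (rule infprod_quat_factors)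
  show "length C > 0" if "C \<in> lyndon_cycles G m e" for C
    using that by (auto simp: lyndon_cycles_def lyndon_words_def)
  show "finite {C \<in> lyndon_cycles G m e. length C \<le> k}" for k
  \<comment> \<open>The cycles come from words of bounded length over a finite alphabet.\<close>
  proof (rule finite_subset)
    show "{C \<in> lyndon_cycles G m e. length C \<le> k} \<subseteq>
        map e ` {ks. set ks \<subseteq> {1..2 * m} \<and> length ks \<le> k}"
      by (auto simp: lyndon_cycles_def lyndon_words_def)
    show "finite (map e ` {ks. set ks \<subseteq> {1..2 * m} \<and> length ks \<le> k})"
      by (intro finite_imageI finite_lists_length_le) simp
  qed
qed

end
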